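(* Let $n,N,p\ge 1$, let $X=\mathbb{R}^n$, let $B\in\mathbb{R}^{n\times n}$ and consider the linear system $x(k+1)=Bx(k)+d(k)$. Let $\mathsf{L}:X\to 2^{\mathsf{AP}}$ be a labeling function, let $c_1,\dots,c_p\in\mathbb{R}^n$, let $A=\mathrm{conv}(c_1,\dots,c_p)$ be their convex hull, and let $\psi$ be a convex LTL$_F$ formula over $\mathsf{AP}$. Then $$g_\psi(A)=\min_{i=1,\dots,p}g_\psi(c_i).$$
   Context: LTL$_F$ formulas over a finite set $\mathsf{AP}$ of atomic propositions are built inductively as $\psi::=\mathsf{true}\mid p\mid\neg\psi\mid\psi_1\wedge\psi_2\mid\psi_1\vee\psi_2\mid\bigcirc\psi\mid\psi_1\,\mathsf{U}\,\psi_2\mid\square\psi\mid\lozenge\psi$ with $p\in\mathsf{AP}$. For a finite word $\omega=(\omega_0,\dots,\omega_{N-1})$ with letters in $2^{\mathsf{AP}}$ and $0\le i<N$: $\omega_i\vDash\mathsf{true}$ always; $\omega_i\vDash p$ iff $p\in\omega_i$; $\neg,\wedge,\vee$ are interpreted as usual; $\omega_i\vDash\bigcirc\psi$ iff $i+1<N$ and $\omega_{i+1}\vDash\psi$; $\omega_i\vDash\psi_1\,\mathsf{U}\,\psi_2$ iff there is $m$ with $i\le m<N$, $\omega_m\vDash\psi_2$ and $\omega_k\vDash\psi_1$ for all $i\le k<m$; $\omega_i\vDash\square\psi$ (resp. $\lozenge\psi$) iff $\omega_m\vDash\psi$ for all (resp. some) $i\le m<N$. One writes $\omega\vDash\psi$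 iff $\omega_0\vDash\psi$. A trajectory $w=(x_0,\dots,x_{N-1})\in X^N$ satisfies $\psi$ iff the word $(\mathsf{L}(x_0),\dots,\mathsf{L}(x_{N-1}))$ does; a set of trajectories satisfies $\psi$ iff all of its elements do. For $\varepsilon\ge 0$ let $\Omega_\varepsilon(0)=\{z\in\mathbb{R}^n:\|z\|_\infty\le\varepsilon\}$. For $x\in X$, $\xi(x,\varepsilon)$ is the set of all $(x_0,\dots,x_{N-1})$ with $x_0=x$ and $x_{k+1}\in Bx_k+\Omega_\varepsilon(0)$ for all $0\le k<N-1$; for $A\subseteq X$, $\xi(A,\varepsilon)=\bigcup_{x\in A}\xi(x,\varepsilon)$. The resilience is $g_\psi(x)=\sup\{\varepsilon\ge 0\mid\xi(x,\varepsilon)\vDash\psi\}\in[0,+\infty]$ if $\xi(x,0)\vDash\psi$, and $g_\psi(x)=0$ otherwise. For a set $A$, $g_\psi(A)=\sup\{\varepsilon\ge 0\mid\xi(A,\varepsilon)\vDash\psi\}$ if $\xi(A,0)\vDash\psi$, and $g_\psi(A)=0$ otherwise. The formula $\psi$ is convex if for all $w_1,w_2\in X^N$ with $w_1\vDash\psi$ and $w_2\vDash\psi$ and all $\lambda\in[0,1]$, the (componentwise) combination $w=\lambda w_1+(1-\lambda)w_2$ satisfies $w\vDash\psi$. *)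

theory Defs
  imports "HOL-Analysis.Analysis"
begin

datatype (atoms: 'ap) ltlf =
    TrueF
  | Atom 'ap
  | NotF "'ap ltlf"
  | AndF "'ap ltlf" "'ap ltlf"
  | OrF "'ap ltlf" "'ap ltlf"
  | Next "'ap ltlf"
  | Until "'ap ltlf" "'ap ltlf"
  | Always "'ap ltlf"
  | Eventually "'ap ltlf"

(* Only positions i < length w are meaningful. *)
primrec sat_at :: "'ap set list \<Rightarrow> 'ap ltlf \<Rightarrow> nat \<Rightarrow> bool" where
  "sat_at w TrueF i \<longleftrightarrow> True"
| "sat_at w (Atom q) i \<longleftrightarrow> q \<in> w ! i"
| "sat_at w (NotF \<psi>) i \<longleftrightarrow> \<not> sat_at w \<psi> i"
| "sat_at w (AndF \<psi>1 \<psi>2) i \<longleftrightarrow> sat_at w \<psi>1 i \<and> sat_at w \<psi>2 i"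
| "sat_at w (OrF \<psi>1 \<psi>2) i \<longleftrightarrow> sat_at w \<psi>1 i \<or> sat_at w \<psi>2 i"
| "sat_at w (Next \<psi>) i \<longleftrightarrow> i + 1 < length w \<and> sat_at w \<psi> (i + 1)"
| "sat_at w (Until \<psi>1 \<psi>2) i \<longleftrightarrow>
     (\<exists>m. i \<le> m \<and> m < length w \<and> sat_at w \<psi>2 m \<and> (\<forall>k. i \<le> k \<and> k < m \<longrightarrow> sat_at w \<psi>1 k))"
| "sat_at w (Always \<psi>) i \<longleftrightarrow> (\<forall>m. i \<le> m \<and> m < length w \<longrightarrow> sat_at w \<psi> m)"
| "sat_at w (Eventually \<psi>) i \<longleftrightarrow> (\<exists>m. i \<le> m \<and> m < length w \<and> sat_at w \<psi> m)"

definition word_sat :: "'ap set list \<Rightarrow> 'ap ltlf \<Rightarrow> bool" where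
  "word_sat w \<psi> \<longleftrightarrow> sat_at w \<psi> 0"

definition traj_sat :: "('x \<Rightarrow> 'ap set) \<Rightarrow> 'x list \<Rightarrow> 'ap ltlf \<Rightarrow> bool" where
  "traj_sat L w \<psi> \<longleftrightarrow> word_sat (map L w) \<psi>"

definition trajs_sat :: "('x \<Rightarrow> 'ap set) \<Rightarrow> 'x list set \<Rightarrow> 'ap ltlf \<Rightarrow> bool" where
  "trajs_sat L W \<psi> \<longleftrightarrow> (\<forall>w\<in>W. traj_sat L w \<psi>)"

definition Omega :: "real \<Rightarrow> (real ^ 'n) set" where
  "Omega \<epsilon> = {z. infnorm z \<le> \<epsilon>}"

definition xi :: "real ^ 'n ^ 'n \<Rightarrow> nat \<Rightarrow> real ^ 'n \<Rightarrow> real \<Rightarrow> (real ^ 'n) list set" where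
  "xi B N x \<epsilon> = {w. length w = N \<and> w ! 0 = x \<and>
     (\<forall>k. k + 1 < N \<longrightarrow> w ! (k + 1) \<in> {B *v (w ! k) + z | z. z \<in> Omega \<epsilon>})}"

definition xi_set :: "real ^ 'n ^ 'n \<Rightarrow> nat \<Rightarrow> (real ^ 'n) set \<Rightarrow> real \<Rightarrow> (real ^ 'n) list set" where
  "xi_set B N A \<epsilon> = (\<Union>x\<in>A. xi B N x \<epsilon>)"

definition resilience ::
  "real ^ 'n ^ 'n \<Rightarrow> nat \<Rightarrow> (real ^ 'n \<Rightarrow> 'ap set) \<Rightarrow> 'ap ltlf \<Rightarrow> real ^ 'n \<Rightarrow> ennreal" where
  "resilience B N L \<psi> x =
     (if trajs_sat L (xi B N x 0) \<psi>
      then Sup {ennreal \<epsilon> | \<epsilon>. 0 \<le> \<epsilon> \<and> trajs_sat L (xi B N x \<epsilon>) \<psi>}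
      else 0)"

definition resilience_set ::
  "real ^ 'n ^ 'n \<Rightarrow> nat \<Rightarrow> (real ^ 'n \<Rightarrow> 'ap set) \<Rightarrow> 'ap ltlf \<Rightarrow> (real ^ 'n) set \<Rightarrow> ennreal" where
  "resilience_set B N L \<psi> A =
     (if trajs_sat L (xi_set B N A 0) \<psi>
      then Sup {ennreal \<epsilon> | \<epsilon>. 0 \<le> \<epsilon> \<and> trajs_sat L (xi_set B N A \<epsilon>) \<psi>}
      else 0)"

definition convex_formula :: "nat \<Rightarrow> (real ^ 'n \<Rightarrow> 'ap set) \<Rightarrow> 'ap ltlf \<Rightarrow> bool" where
  "convex_formula N L \<psi> \<longleftrightarrow>
     (\<forall>w1 w2. length w1 = N \<and> length w2 = N \<and> traj_sat L w1 \<psi> \<and> traj_sat L w2 \<psi> \<longrightarrow>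
       (\<forall>u\<in>{0..1}. traj_sat L (map2 (\<lambda>x y. u *\<^sub>R x + (1 - u) *\<^sub>R y) w1 w2) \<psi>))"

end

theory Submission
  imports Defs
begin

text \<open>
  For fixed \<open>\<epsilon>\<close>, the initial states from which every \<open>\<epsilon>\<close>-disturbed trajectory satisfies a convex
  formula form a convex set: a trajectory \<open>w\<close> from \<open>u x + (1 - u) y\<close> is the same convex combination
  of the trajectories from \<open>x\<close> and \<open>y\<close> driven by the disturbances of \<open>w\<close>. Hence the hull of the
  \<open>c i\<close> tolerates \<open>\<epsilon>\<close> iff every \<open>c i\<close> does, and as tolerated disturbance bounds are closed downwards,
  the supremum over the hull is the minimum of the suprema over the generators.
\<close>

lemma trajs_sat_xi_set:
  "trajs_sat L (xi_set B N A \<epsilon>) \<psi> \<longleftrightarrow> (\<forall>x\<in>A. trajs_sat L (xi B N x \<epsilon>) \<psi>)"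
  by (auto simp: trajs_sat_def xi_set_def)

lemma xi_mono: "\<delta> \<le> \<epsilon> \<Longrightarrow> xi B N x \<delta> \<subseteq> xi B N x \<epsilon>"
  by (fastforce simp: xi_def Omega_def)

lemma trajs_sat_xi_antimono:
  "trajs_sat L (xi B N x \<epsilon>) \<psi> \<Longrightarrow> \<delta> \<le> \<epsilon> \<Longrightarrow> trajs_sat L (xi B N x \<delta>) \<psi>"
  using xi_mono[of \<delta> \<epsilon> B N x] by (auto simp: trajs_sat_def)

text \<open>The case distinction in the definition is redundant: tolerated bounds are closed
  downwards, so if 0 is not tolerated then no bound is, and the supremum of the empty set in
  \<open>ennreal\<close> is 0.\<close>

lemma resilience_eq_Sup:
  "resilience B N L \<psi> x = Sup {ennreal \<epsilon> | \<epsilon>. 0 \<le> \<epsilon> \<and> trajs_sat L (xi B N x \<epsilon>) \<psi>}"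
proof (cases "trajs_sat L (xi B N x 0) \<psi>")
  case False
  then have "{ennreal \<epsilon> | \<epsilon>. 0 \<le> \<epsilon> \<and> trajs_sat L (xi B N x \<epsilon>) \<psi>} = {}"
    using trajs_sat_xi_antimono by blast
  with False show ?thesis
    by (simp add: resilience_def bot_ennreal del: Collect_empty_eq)
qed (simp add: resilience_def)

lemma resilience_set_eq_Sup:
  "resilience_set B N L \<psi> A = Sup {ennreal \<epsilon> | \<epsilon>. 0 \<le> \<epsilon> \<and> trajs_sat L (xi_set B N A \<epsilon>) \<psi>}"
proof (cases "trajs_sat L (xi_set B N A 0) \<psi>")
  case False
  then have "{ennreal \<epsilon> | \<epsilon>. 0 \<le> \<epsilon> \<and> trajs_sat L (xi_set B N A \<epsilon>) \<psi>} = {}"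
    using trajs_sat_xi_antimono unfolding trajs_sat_xi_set by blast
  with False show ?thesis
    by (simp add: resilience_set_def bot_ennreal del: Collect_empty_eq)
qed (simp add: resilience_set_def)

lemma linear_funpow_matrix_vector_mult:
  fixes B :: "real ^ 'n ^ 'n"
  shows "linear (((*v) B) ^^ k)"
  by (induction k)
    (simp_all add: linear_iff matrix_vector_right_distrib matrix_vector_mult_scaleR)

text \<open>Two trajectories driven by the same disturbances differ by a solution of the undisturbed
  system, that is by B^k applied to the difference of their initial states. Adding this term to
  \<open>w\<close> therefore moves its start from \<open>x\<close> to \<open>y\<close> and leaves
  each disturbance \<open>z\<close> as it was.\<close>

lemma shift_in_xi:
  fixes B :: "real ^ 'n ^ 'n"
  assumes w: "w \<in> xi B N x \<epsilon>" and N: "N \<ge> 1"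
  shows "map (\<lambda>k. w ! k + (((*v) B) ^^ k) (y - x)) [0..<N] \<in> xi B N y \<epsilon>"
proof -
  have "\<exists>z. w ! Suc k + B *v ((((*v) B) ^^ k) (y - x)) =
            B *v (w ! k + (((*v) B) ^^ k) (y - x)) + z \<and> z \<in> Omega \<epsilon>" if k: "Suc k < N" for k
  proof -
    obtain z where "w ! Suc k = B *v (w ! k) + z" "z \<in> Omega \<epsilon>"
      using w k by (auto simp: xi_def)
    then show ?thesis
      by (auto simp: matrix_vector_right_distrib)
  qed
  then show ?thesis
    using w N by (auto simp: xi_def)
qed

lemma convex_trajs_sat_xi:
  fixes B :: "real ^ 'n ^ 'n"
  assumes conv: "convex_formula N L \<psi>" and N: "N \<ge> 1"
  shows "convex {x. trajs_sat L (xi B N x \<epsilon>) \<psi>}"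
proof (rule convexI)
  fix x y and u v :: real
  assume x: "x \<in> {x. trajs_sat L (xi B N x \<epsilon>) \<psi>}"
    and y: "y \<in> {x. trajs_sat L (xi B N x \<epsilon>) \<psi>}"
    and uv: "0 \<le> u" "0 \<le> v" "u + v = 1"
  define m where "m = u *\<^sub>R x + v *\<^sub>R y"
  have v: "v = 1 - u"
    using uv by simp
  have "traj_sat L w \<psi>" if w: "w \<in> xi B N m \<epsilon>" for w
  proof -
    define shift where "shift a = map (\<lambda>k. w ! k + (((*v) B) ^^ k) (a - m)) [0..<N]" for a
    have "traj_sat L (shift x) \<psi>" "traj_sat L (shift y) \<psi>"
      using x y shift_in_xi[OF w N] by (auto simp: trajs_sat_def shift_def)
    moreover have "length (shift x) = N" "length (shift y) = N"
      by (simp_all add: shift_def)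
    ultimately have "traj_sat L (map2 (\<lambda>a b. u *\<^sub>R a + (1 - u) *\<^sub>R b) (shift x) (shift y)) \<psi>"
      using conv uv by (auto simp: convex_formula_def)
    moreover have "map2 (\<lambda>a b. u *\<^sub>R a + (1 - u) *\<^sub>R b) (shift x) (shift y) = w"
    proof (rule nth_equalityI)
      show "length (map2 (\<lambda>a b. u *\<^sub>R a + (1 - u) *\<^sub>R b) (shift x) (shift y)) = length w"
        using w by (simp add: shift_def xi_def)
    next
      fix k assume "k < length (map2 (\<lambda>a b. u *\<^sub>R a + (1 - u) *\<^sub>R b) (shift x) (shift y))"
      then have k: "k < N"
        by (simp add: shift_def)
      interpret P: linear "((*v) B) ^^ k"
        by (rule linear_funpow_matrix_vector_mult)
      \<comment> \<open>Both shifted trajectories contain \<open>w ! k\<close> with weights that sum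
        to 1. By linearity of B^k the correction terms merge into the image of a single vector,
        which vanishes because \<open>m\<close> is the same weighted mean of \<open>x\<close> and
        \<open>y\<close>.\<close>
      have "u *\<^sub>R (w ! k + (((*v) B) ^^ k) (x - m)) + (1 - u) *\<^sub>R (w ! k + (((*v) B) ^^ k) (y - m))
          = w ! k + (((*v) B) ^^ k) (u *\<^sub>R (x - m) + (1 - u) *\<^sub>R (y - m))"
        unfolding P.add P.scale by (simp add: algebra_simps)
      also have "u *\<^sub>R (x - m) + (1 - u) *\<^sub>R (y - m) = 0"
        by (simp add: m_def v algebra_simps)
      finally show "map2 (\<lambda>a b. u *\<^sub>R a + (1 - u) *\<^sub>R b) (shift x) (shift y) ! k = w ! k"
        using k by (simp add: shift_def P.zero)
    qed
    ultimately show ?thesis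
      by simp
  qed
  then show "u *\<^sub>R x + v *\<^sub>R y \<in> {x. trajs_sat L (xi B N x \<epsilon>) \<psi>}"
    by (simp add: trajs_sat_def m_def)
qed

text \<open>The hull is the least convex set containing \<open>C\<close>, so it lies in the convex
  set of good initial states as soon as \<open>C\<close> does.\<close>

lemma trajs_sat_xi_set_convex_hull:
  assumes "convex_formula N L \<psi>" and "N \<ge> 1"
  shows "trajs_sat L (xi_set B N (convex hull C) \<epsilon>) \<psi> \<longleftrightarrow> (\<forall>x\<in>C. trajs_sat L (xi B N x \<epsilon>) \<psi>)"
  using hull_minimal[of C "{x. trajs_sat L (xi B N x \<epsilon>) \<psi>}" convex]
    convex_trajs_sat_xi[OF assms] hull_subset[of C convex]
  unfolding trajs_sat_xi_set by blast

theorem theorem3p5: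
  fixes N p :: nat
    and B :: "real ^ 'n ^ 'n"
    and AP :: "'ap set"
    and L :: "real ^ 'n \<Rightarrow> 'ap set"
    and c :: "nat \<Rightarrow> real ^ 'n"
    and A :: "(real ^ 'n) set"
    and \<psi> :: "'ap ltlf"
  assumes "N \<ge> 1" and "p \<ge> 1"
    and "finite AP"
    and "\<And>x. L x \<subseteq> AP"
    and "A = convex hull (c ` {1..p})"
    and "atoms \<psi> \<subseteq> AP"
    and "convex_formula N L \<psi>"
  shows "resilience_set B N L \<psi> A = (MIN i\<in>{1..p}. resilience B N L \<psi> (c i))"
proof (rule antisym)
  have A_iff: "trajs_sat L (xi_set B N A \<epsilon>) \<psi> \<longleftrightarrow> (\<forall>i\<in>{1..p}. trajs_sat L (xi B N (c i) \<epsilon>) \<psi>)" for \<epsilon>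
    using trajs_sat_xi_set_convex_hull[OF assms(7,1)] assms(5) by auto
  \<comment> \<open>Without generators the minimum would be unspecified; \<open>p \<ge> 1\<close>
    excludes this.\<close>
  have ne: "(\<lambda>i. resilience B N L \<psi> (c i)) ` {1..p} \<noteq> {}"
    using assms(2) by simp
  have "resilience_set B N L \<psi> A \<le> resilience B N L \<psi> (c i)" if "i \<in> {1..p}" for i
    unfolding resilience_set_eq_Sup resilience_eq_Sup A_iff
    using that by (intro Sup_subset_mono) blast
  then show "resilience_set B N L \<psi> A \<le> (MIN i\<in>{1..p}. resilience B N L \<psi> (c i))"
    using ne by simp
  show "(MIN i\<in>{1..p}. resilience B N L \<psi> (c i)) \<le> resilience_set B N L \<psi> A"
  \<comment> \<open>The suprema need not be attained, so the minimum is approached by values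
    \<open>e\<close> strictly below it. Such an \<open>e\<close> is finite, hence a real bound
    \<open>r\<close>.\<close>
  proof (rule dense_le)
    fix e assume e: "e < (MIN i\<in>{1..p}. resilience B N L \<psi> (c i))"
    then have "e \<noteq> top"
      using top.not_eq_extremum by force
    then obtain r where r: "e = ennreal r" "0 \<le> r"
      by (cases e) auto
    have "trajs_sat L (xi B N (c i) r) \<psi>" if "i \<in> {1..p}" for i
    proof -
      have "e < resilience B N L \<psi> (c i)"
        using e ne that by simp
      \<comment> \<open>The tolerated bound above \<open>e\<close> may depend on \<open>i\<close>;
        downward closure brings all of them to the common value \<open>r\<close>.\<close>
      then obtain \<epsilon> where "e < ennreal \<epsilon>" "trajs_sat L (xi B N (c i) \<epsilon>) \<psi>"
        unfolding resilience_eq_Sup less_Sup_iff by blast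
      then show ?thesis
        using r trajs_sat_xi_antimono by (metis ennreal_less_iff less_imp_le)
    qed
    then show "e \<le> resilience_set B N L \<psi> A"
      unfolding resilience_set_eq_Sup A_iff using r by (intro Sup_upper) blast
  qed
qed

end
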